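(* The following (promise) decision problem is undecidable. Given: a Turing machine $\mathcal{M}$, a distinguished state $q$ of $\mathcal{M}$, and an integer $c$ such that, for every $n$, $\mathcal{M}$ terminates on all binary inputs of length $n$ within at most $c\cdot n+c$ steps. Question: does there exist a binary input $\vec z\in\{0,1\}^*$ on which $\mathcal{M}$, when run, eventually enters state $q$? That is, there is no algorithm (Turing machine) which, for every triple $(\mathcal{M},q,c)$ satisfying the promise that, for every $n$, $\mathcal{M}$ terminates on all binary inputs of length $n$ within at most $c\cdot n+c$ steps, terminates on (an encoding of) $(\mathcal{M},q,c)$ and correctly answers whether such an input $\vec z$ exists.
   Context: Algorithms are formalized as deterministic multitape Turing machines (with an arbitrary finite number of tapes) operating on finite binary input strings; Turing machines, states and integers are encoded as finite binary strings in a standard effective way so that they can be given as input to other Turing machines. In informal terms, $\mathcal{M}$ is an algorithm and $q$ a distinguished instruction of it, and the question is whether that instruction is ever executed on some input. The problem is a promise problem: a deciding algorithm is only required to terminate with the correct answer on triples $(\mathcal{M},q,c)$ satisfying the stated linear time bound, and its behaviour on all other inputs is unconstrained. No bound is imposed on the running time of the deciding algorithm, other than that it answers after finitely many steps. *)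

theory Defs
  imports Main
begin

section \<open>Deterministic multitape Turing machines\<close>

text \<open>
  Tape symbols and states are natural numbers. The symbol 0 is the blank, 1 and 2 are the input
  symbols for the bits 0 and 1, and all further symbols are work symbols.
\<close>

datatype move = MoveLeft | Stay | MoveRight

text \<open>
  The transition function is partial and is given by the finite table \<^term>\<open>delta\<close>: an entry
  \<open>((p, as), (p', acts))\<close> says that in state \<open>p\<close>, when tape number \<open>i\<close> carries the symbol
  \<open>as ! i\<close> under its head, the machine enters state \<open>p'\<close> and on each tape \<open>i\<close> writes
  \<open>fst (acts ! i)\<close> and then moves the head as prescribed by \<open>snd (acts ! i)\<close>. The machine halts
  when no entry applies.
\<close>

type_synonym transition = "(nat \<times> nat list) \<times> (nat \<times> (nat \<times> move) list)"

record tm =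
  num_tapes :: nat
  num_states :: nat
  num_symbols :: nat
  start :: nat
  delta :: "transition list"

fun transition_ok :: "tm \<Rightarrow> transition \<Rightarrow> bool" where
  "transition_ok M ((p, as), (p', acts)) \<longleftrightarrow>
     p < num_states M \<and> p' < num_states M \<and>
     length as = num_tapes M \<and> length acts = num_tapes M \<and>
     (\<forall>a \<in> set as. a < num_symbols M) \<and>
     (\<forall>(b, d) \<in> set acts. b < num_symbols M)"

text \<open>The distinctness condition is determinism: no two entries have the same left-hand side.\<close>

definition turing_machine :: "tm \<Rightarrow> bool" where
  "turing_machine M \<longleftrightarrow>
     num_tapes M \<ge> 1 \<and> num_symbols M \<ge> 3 \<and> start M < num_states M \<and>
     (\<forall>r \<in> set (delta M). transition_ok M r) \<and>
     distinct (map fst (delta M))"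

text \<open>Tapes are infinite in both directions; a tape consists of its contents and its head position.\<close>

type_synonym tape = "(int \<Rightarrow> nat) \<times> int"
type_synonym config = "nat \<times> tape list"

fun offset :: "move \<Rightarrow> int" where
  "offset MoveLeft = - 1"
| "offset Stay = 0"
| "offset MoveRight = 1"

fun scanned :: "tape \<Rightarrow> nat" where
  "scanned (f, h) = f h"

fun act :: "nat \<times> move \<Rightarrow> tape \<Rightarrow> tape" where
  "act (b, d) (f, h) = (f(h := b), h + offset d)"

definition applicable :: "tm \<Rightarrow> config \<Rightarrow> (nat \<times> (nat \<times> move) list) option" where
  "applicable M cfg = map_of (delta M) (fst cfg, map scanned (snd cfg))"

definition halted :: "tm \<Rightarrow> config \<Rightarrow> bool" where
  "halted M cfg \<longleftrightarrow> applicable M cfg = None"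

text \<open>A halted configuration is repeated forever.\<close>

definition step :: "tm \<Rightarrow> config \<Rightarrow> config" where
  "step M cfg = (case applicable M cfg of
      None \<Rightarrow> cfg
    | Some (p', acts) \<Rightarrow> (p', map2 act acts (snd cfg)))"

definition input_tape :: "bool list \<Rightarrow> tape" where
  "input_tape z =
     (\<lambda>i. if 0 \<le> i \<and> i < int (length z) then (if z ! nat i then 2 else 1) else 0, 0)"

definition blank_tape :: tape where
  "blank_tape = (\<lambda>_. 0, 0)"

definition initial :: "tm \<Rightarrow> bool list \<Rightarrow> config" where
  "initial M z = (start M, input_tape z # replicate (num_tapes M - 1) blank_tape)"

definition config_at :: "tm \<Rightarrow> bool list \<Rightarrow> nat \<Rightarrow> config" where
  "config_at M z t = (step M ^^ t) (initial M z)"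

text \<open>
  Since halted configurations are repeated, \<open>halted M (config_at M z t)\<close> means that the run on
  \<open>z\<close> terminates after at most \<open>t\<close> steps. The bound is an integer because \<open>c\<close> below is one.
\<close>

definition terminates_within :: "tm \<Rightarrow> bool list \<Rightarrow> int \<Rightarrow> bool" where
  "terminates_within M z b \<longleftrightarrow> (\<exists>t. int t \<le> b \<and> halted M (config_at M z t))"

definition linear_time :: "tm \<Rightarrow> int \<Rightarrow> bool" where
  "linear_time M c \<longleftrightarrow>
     (\<forall>n. \<forall>z. length z = n \<longrightarrow> terminates_within M z (c * int n + c))"

text \<open>The start state counts as entered, at time 0.\<close>

definition enters :: "tm \<Rightarrow> bool list \<Rightarrow> nat \<Rightarrow> bool" where
  "enters M z q \<longleftrightarrow> (\<exists>t. fst (config_at M z t) = q)"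

text \<open>
  \<open>D\<close> answers by the state in which it halts: yes if that state is in \<open>F\<close>, no otherwise.
\<close>

definition answers :: "tm \<Rightarrow> nat set \<Rightarrow> bool list \<Rightarrow> bool \<Rightarrow> bool" where
  "answers D F w b \<longleftrightarrow>
     (\<exists>t. halted D (config_at D w t) \<and> (fst (config_at D w t) \<in> F \<longleftrightarrow> b))"


section \<open>Encoding of machines, states and integers as binary strings\<close>

text \<open>
  States, symbols and the entries of machine descriptions are encoded in self-delimiting unary, as is
  common for Turing machine descriptions; the integer \<open>c\<close> is encoded in binary with a sign bit.
\<close>

definition enc_nat :: "nat \<Rightarrow> bool list" where
  "enc_nat n = replicate n True @ [False]"

definition enc_list :: "('a \<Rightarrow> bool list) \<Rightarrow> 'a list \<Rightarrow> bool list" where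
  "enc_list e xs = concat (map (\<lambda>x. True # e x) xs) @ [False]"

fun enc_move :: "move \<Rightarrow> bool list" where
  "enc_move MoveLeft = [False, False]"
| "enc_move Stay = [False, True]"
| "enc_move MoveRight = [True, True]"

fun enc_action :: "nat \<times> move \<Rightarrow> bool list" where
  "enc_action (b, d) = enc_nat b @ enc_move d"

fun enc_transition :: "transition \<Rightarrow> bool list" where
  "enc_transition ((p, as), (p', acts)) =
     enc_nat p @ enc_list enc_nat as @ enc_nat p' @ enc_list enc_action acts"

definition enc_tm :: "tm \<Rightarrow> bool list" where
  "enc_tm M = enc_nat (num_tapes M) @ enc_nat (num_states M) @ enc_nat (num_symbols M) @
     enc_nat (start M) @ enc_list enc_transition (delta M)"

text \<open>Binary digits, least significant first.\<close>

fun bits :: "nat \<Rightarrow> bool list" where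
  "bits n = (if n = 0 then [] else odd n # bits (n div 2))"

declare bits.simps [simp del]

definition enc_int :: "int \<Rightarrow> bool list" where
  "enc_int c = (c < 0) # bits (nat \<bar>c\<bar>)"

definition encode :: "tm \<Rightarrow> nat \<Rightarrow> int \<Rightarrow> bool list" where
  "encode M q c = enc_tm M @ enc_nat q @ enc_int c"


subsection \<open>The encoding is injective\<close>

lemma enc_nat_prefix [simp]: "enc_nat m @ x = enc_nat n @ y \<longleftrightarrow> m = n \<and> x = y"
  unfolding enc_nat_def
proof (induction m arbitrary: n)
  case 0
  then show ?case by (cases n) auto
next
  case (Suc m)
  then show ?case by (cases n) auto
qed

lemma enc_list_prefix:
  assumes "\<And>a b x y. e a @ x = e b @ y \<longleftrightarrow> a = b \<and> x = y"
  shows "enc_list e as @ x = enc_list e bs @ y \<longleftrightarrow> as = bs \<and> x = y"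
  unfolding enc_list_def
proof (induction as arbitrary: bs)
  case Nil
  then show ?case by (cases bs) auto
next
  case (Cons a as)
  then show ?case by (cases bs) (auto simp: assms)
qed

lemma enc_action_prefix: "enc_action a @ x = enc_action b @ y \<longleftrightarrow> a = b \<and> x = y"
proof -
  have "enc_move d @ x = enc_move d' @ y \<longleftrightarrow> d = d' \<and> x = y" for d d' x y
    by (cases d; cases d') auto
  then show ?thesis by (cases a; cases b) auto
qed

lemma enc_transition_prefix:
  "enc_transition r @ x = enc_transition r' @ y \<longleftrightarrow> r = r' \<and> x = y"
  by (cases r rule: enc_transition.cases; cases r' rule: enc_transition.cases)
    (auto simp: enc_list_prefix [OF enc_nat_prefix] enc_list_prefix [OF enc_action_prefix])

lemma enc_tm_prefix: "enc_tm M @ x = enc_tm N @ y \<longleftrightarrow> M = N \<and> x = y"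
  by (cases M; cases N)
    (auto simp: enc_tm_def enc_list_prefix [OF enc_transition_prefix])

lemma bits_inject: "bits m = bits n \<longleftrightarrow> m = n"
proof (induction m arbitrary: n rule: bits.induct)
  case (1 m)
  show ?case
  proof (cases "m = 0 \<or> n = 0")
    case True
    then show ?thesis by (subst (1 2) bits.simps) auto
  next
    case False
    then have "bits m = bits n \<longleftrightarrow> (odd m \<longleftrightarrow> odd n) \<and> m div 2 = n div 2"
      using 1 by (subst (1 2) bits.simps) auto
    also have "\<dots> \<longleftrightarrow> m = n"
      by (metis odd_two_times_div_two_succ even_two_times_div_two)
    finally show ?thesis .
  qed
qed

lemma enc_int_inject: "enc_int c = enc_int d \<longleftrightarrow> c = d"
  unfolding enc_int_def by (auto simp: bits_inject)

lemma encode_inject: "encode M q c = encode N r d \<longleftrightarrow> M = N \<and> q = r \<and> c = d"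
  unfolding encode_def by (auto simp: enc_tm_prefix enc_int_inject)

end

theory Submission
  imports Defs "HOL-Library.More_List"
begin

text \<open>
  A machine that moves its input head to the right in every step and halts at the end of its input
  runs in linear time whatever it computes on its other tapes, while long inputs let that
  computation run for any number of steps. So a decider \<open>D\<close> can be refuted by a machine that, using
  its input only as a clock, writes its own encoding by Kleene's recursion theorem, runs \<open>D\<close> on it,
  and enters the distinguished state iff \<open>D\<close> answers no.

  The self-describing machine consists of a fixed core and of a chain of loader states that write
  the payload, i.e. the part of the encoding that describes the core and everything after it. Since
  the output is produced from right to left, it then remains to prepend the table of the loader,
  computed from the payload, and the header. Loader states are even and core states odd (0 links
  the two), so the encoding of the core does not depend on the length of the payload.
\<close>

section \<open>Machines driven by their input as a clock\<close>

text \<open>Asking for \<open>2\<close>, the symbol of bit 1, yields exactly one entry per old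
  entry; a bit 0 then stops the run just as the blank does. Writing \<open>2\<close> back leaves the
  input intact.\<close>

fun clock_transition :: "transition \<Rightarrow> transition" where
  "clock_transition ((p, as), (p', acts)) = ((p, 2 # as), (p', (2, MoveRight) # acts))"

definition clocked :: "tm \<Rightarrow> tm" where
  "clocked M = \<lparr>num_tapes = Suc (num_tapes M), num_states = num_states M,
     num_symbols = num_symbols M, start = start M, delta = map clock_transition (delta M)\<rparr>"

lemma turing_machine_clocked:
  assumes "turing_machine M"
  shows "turing_machine (clocked M)"
proof -
  have fst_clock: "fst (clock_transition r) = (\<lambda>(p, as). (p, 2 # as)) (fst r)" for r
    by (cases r rule: clock_transition.cases) simp
  have "inj_on (\<lambda>(p, as). (p :: nat, (2 :: nat) # as)) A" for A
    by (auto simp: inj_on_def)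
  moreover have "map fst (map clock_transition (delta M)) =
      map (\<lambda>(p, as). (p, 2 # as)) (map fst (delta M))"
    by (simp add: fst_clock)
  ultimately have "distinct (map fst (map clock_transition (delta M)))"
    using assms unfolding turing_machine_def by (metis distinct_map)
  moreover have "transition_ok (clocked M) (clock_transition r)" if "r \<in> set (delta M)" for r
  proof -
    have "transition_ok M r" "num_symbols M \<ge> 3"
      using assms that by (auto simp: turing_machine_def)
    then show ?thesis
      by (cases r rule: clock_transition.cases) (auto simp: clocked_def)
  qed
  ultimately show ?thesis
    using assms by (auto simp: turing_machine_def clocked_def)
qed

lemma applicable_clocked:
  "applicable (clocked M) (p, T # ts) =
     (if scanned T = 2
      then map_option (\<lambda>(p', acts). (p', (2, MoveRight) # acts)) (applicable M (p, ts))
      else None)"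
proof -
  have "map_of (map clock_transition ds) (p, a # as) =
      (if a = 2 then map_option (\<lambda>(p', acts). (p', (2, MoveRight) # acts)) (map_of ds (p, as))
       else None)" for ds a as
    by (induction ds rule: list.induct) (auto split: prod.splits)
  then show ?thesis by (simp add: applicable_def clocked_def)
qed

lemma config_at_Suc: "config_at M z (Suc t) = step M (config_at M z t)"
  by (simp add: config_at_def)

lemma step_halted: "halted M cfg \<Longrightarrow> step M cfg = cfg"
  by (simp add: halted_def step_def)

lemma config_at_halted:
  assumes "halted M (config_at M z s)" "s \<le> t"
  shows "config_at M z t = config_at M z s"
  using assms(2)
  by (induction rule: dec_induct) (auto simp: config_at_Suc step_halted assms(1))

text \<open>\<open>s\<close> is the number of steps of \<open>M\<close> carried out so far. It lags
  behind \<open>t\<close> only once the clocked machine has halted.\<close>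

lemma config_at_clocked:
  assumes "num_tapes M \<ge> 1"
  shows "\<exists>s\<le>t. config_at (clocked M) z t =
      (fst (config_at M [] s), (fst (input_tape z), int s) # snd (config_at M [] s)) \<and>
      (s = t \<or> halted (clocked M) (config_at (clocked M) z t))"
proof (induction t)
  case 0
  have "input_tape [] = blank_tape"
    by (simp add: input_tape_def blank_tape_def fun_eq_iff)
  then have "replicate (num_tapes M) blank_tape = input_tape [] # replicate (num_tapes M - 1) blank_tape"
    using assms by (cases "num_tapes M") simp_all
  then show ?case
    by (simp add: config_at_def initial_def clocked_def) (simp add: input_tape_def)
next
  case (Suc t)
  then obtain s where s: "s \<le> t"
    "config_at (clocked M) z t =
      (fst (config_at M [] s), (fst (input_tape z), int s) # snd (config_at M [] s))"
    "s = t \<or> halted (clocked M) (config_at (clocked M) z t)" by blast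
  show ?case
  proof (cases "halted (clocked M) (config_at (clocked M) z t)")
    case True
    then have "config_at (clocked M) z (Suc t) = config_at (clocked M) z t"
      by (simp add: config_at_Suc step_halted)
    then show ?thesis using True s by (metis le_SucI)
  next
    case False
    then have "s = t" using s by blast
    define p ts where "p = fst (config_at M [] t)" and "ts = snd (config_at M [] t)"
    have cfg: "config_at (clocked M) z t = (p, (fst (input_tape z), int t) # ts)"
      using s \<open>s = t\<close> by (simp add: p_def ts_def)
    have M: "config_at M [] t = (p, ts)" by (simp add: p_def ts_def)
    from False obtain p' acts where
      two: "scanned (fst (input_tape z), int t) = 2" and app: "applicable M (p, ts) = Some (p', acts)"
      unfolding halted_def cfg applicable_clocked by (auto split: if_splits)
    have "config_at (clocked M) z (Suc t) = (p', (fst (input_tape z), int (Suc t)) # map2 act acts ts)"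
      using two by (simp add: config_at_Suc cfg step_def applicable_clocked app fun_upd_idem)
    moreover have "config_at M [] (Suc t) = (p', map2 act acts ts)"
      by (simp add: config_at_Suc M step_def app)
    ultimately show ?thesis by (metis fst_conv snd_conv order_refl)
  qed
qed

lemma linear_time_clocked:
  assumes "num_tapes M \<ge> 1"
  shows "linear_time (clocked M) 1"
proof -
  \<comment> \<open>At time \<open>length z\<close> either the run has halted or the clock head is
    on the blank behind the input.\<close>
  have "halted (clocked M) (config_at (clocked M) z (length z))" for z
    using config_at_clocked [OF assms, of "length z" z]
    by (auto simp: halted_def applicable_clocked input_tape_def)
  then have "terminates_within (clocked M) z (1 * int (length z) + 1)" for z
    unfolding terminates_within_def by (intro exI [of _ "length z"]) simp
  then show ?thesis by (simp add: linear_time_def)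
qed

lemma enters_clocked:
  assumes "num_tapes M \<ge> 1"
  shows "(\<exists>z. enters (clocked M) z q) \<longleftrightarrow> enters M [] q"
proof
  assume "\<exists>z. enters (clocked M) z q"
  then show "enters M [] q"
    using config_at_clocked [OF assms] unfolding enters_def by (metis fst_conv)
next
  assume "enters M [] q"
  then obtain t where t: "fst (config_at M [] t) = q" by (auto simp: enters_def)
  \<comment> \<open>An input of \<open>t\<close> ones keeps the clock going for \<open>t\<close>
    steps.\<close>
  define z where "z = replicate t True"
  obtain s where s: "s \<le> t" "config_at (clocked M) z t =
      (fst (config_at M [] s), (fst (input_tape z), int s) # snd (config_at M [] s))"
    "s = t \<or> halted (clocked M) (config_at (clocked M) z t)"
    using config_at_clocked [OF assms] by blast
  have "config_at M [] t = config_at M [] s"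
  proof (cases "s = t")
    case False
    then have "s < t" using s(1) by simp
    then have "scanned (fst (input_tape z), int s) = 2"
      by (simp add: input_tape_def z_def)
    \<comment> \<open>The clock still shows a one at \<open>s < t\<close>, so it is \<open>M\<close>
      that has halted.\<close>
    then have "halted M (config_at M [] s)"
      using s False by (auto simp: halted_def applicable_clocked)
    then show ?thesis using config_at_halted s(1) by blast
  qed simp
  then have "fst (config_at (clocked M) z t) = q" using t s(2) by simp
  then show "\<exists>z. enters (clocked M) z q" by (auto simp: enters_def)
qed


section \<open>Tapes up to translation\<close>

text \<open>
  \<open>D\<close> is started on a tape whose head is not at position 0, hence tapes are compared relative to
  their heads.
\<close>

definition view :: "tape \<Rightarrow> int \<Rightarrow> nat" where
  "view T = (\<lambda>i. fst T (snd T + i))"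

fun view_act :: "nat \<times> move \<Rightarrow> (int \<Rightarrow> nat) \<Rightarrow> int \<Rightarrow> nat" where
  "view_act (b, d) g = (\<lambda>i. (g(0 := b)) (i + offset d))"

declare view_act.simps [simp del]

type_synonym view_config = "nat \<times> (int \<Rightarrow> nat) list"

definition view_step ::
    "(nat \<times> nat list \<Rightarrow> (nat \<times> (nat \<times> move) list) option) \<Rightarrow> view_config \<Rightarrow> view_config" where
  "view_step m cfg = (case m (fst cfg, map (\<lambda>g. g 0) (snd cfg)) of
      None \<Rightarrow> cfg
    | Some (p', acts) \<Rightarrow> (p', map2 view_act acts (snd cfg)))"

definition view_config :: "config \<Rightarrow> view_config" where
  "view_config cfg = (fst cfg, map view (snd cfg))"

lemma view_0: "view T 0 = scanned T"
  by (cases T) (simp add: view_def)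

lemma view_act_view: "view (act a T) = view_act a (view T)"
  by (cases a; cases T) (auto simp: view_def view_act.simps fun_eq_iff algebra_simps)

lemma map2_view_act: "map view (map2 act acts ts) = map2 view_act acts (map view ts)"
  by (induction acts ts rule: list_induct2') (simp_all add: view_act_view)

lemma map_view_0: "map (\<lambda>g. g 0) (map view ts) = map scanned ts"
  by (simp add: view_0)

lemma view_config_step: "view_config (step M cfg) = view_step (map_of (delta M)) (view_config cfg)"
  by (auto simp: view_config_def step_def view_step_def applicable_def map_view_0 map2_view_act
      simp del: map_map split: option.split)

lemma view_config_at:
  "view_config (config_at M z t) = (view_step (map_of (delta M)) ^^ t) (view_config (initial M z))"
  by (induction t) (simp_all add: config_at_Suc view_config_step, simp add: config_at_def)

lemma view_act_Stay [simp]: "g 0 = b \<Longrightarrow> view_act (b, Stay) g = g"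
  by (simp add: view_act.simps fun_eq_iff)

text \<open>\<open>l\<close> lists the cells left of the head, nearest first, and \<open>r\<close>
  those from the head rightwards; all further cells are blank.\<close>

definition zipper :: "nat list \<Rightarrow> nat list \<Rightarrow> int \<Rightarrow> nat" where
  "zipper l r = (\<lambda>i. if 0 \<le> i then nth_default 0 r (nat i) else nth_default 0 l (nat (- i - 1)))"

lemma zipper_0 [simp]: "zipper l [] 0 = 0" "zipper l (a # r) 0 = a"
  by (simp_all add: zipper_def)

text \<open>Supplies the explicit cell that the two lemmas on head moves demand.\<close>

lemma zipper_append_blank: "zipper l [] = zipper l [0]" "zipper [] r = zipper [0] r"
  by (auto simp: zipper_def fun_eq_iff nth_default_Cons split: nat.split)

lemma zipper_right: "view_act (b, MoveRight) (zipper l (a # r)) = zipper (b # l) r"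
proof
  fix i :: int
  consider "i \<ge> 0" | "i = -1" | "i < -1" by linarith
  then show "view_act (b, MoveRight) (zipper l (a # r)) i = zipper (b # l) r i"
  proof cases
    case 1
    then have "nat (i + 1) = Suc (nat i)" by simp
    then show ?thesis using 1 by (simp add: view_act.simps zipper_def)
  next
    case 3
    then have "nat (- i - 1) = Suc (nat (- i - 2))" "nat (- (i + 1) - 1) = nat (- i - 2)" by simp_all
    then show ?thesis using 3 by (simp add: view_act.simps zipper_def)
  qed (simp add: view_act.simps zipper_def)
qed

lemma zipper_left: "view_act (b, MoveLeft) (zipper (a # l) (c # r)) = zipper l (a # b # r)"
proof
  fix i :: int
  consider "i > 1" | "i = 1" | "i = 0" | "i < 0" by linarith
  then show "view_act (b, MoveLeft) (zipper (a # l) (c # r)) i = zipper l (a # b # r) i"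
  proof cases
    case 1
    then have "nat i = Suc (Suc (nat (i - 2)))" "nat (i - 1) = Suc (nat (i - 2))" by simp_all
    then show ?thesis using 1 by (simp add: view_act.simps zipper_def)
  next
    case 4
    then have "nat (- (i - 1) - 1) = Suc (nat (- i - 1))" by simp
    then show ?thesis using 4 by (simp add: view_act.simps zipper_def)
  qed (simp_all add: view_act.simps zipper_def)
qed

definition bit_symbol :: "bool \<Rightarrow> nat" where
  "bit_symbol b = (if b then 2 else 1)"

lemma view_blank: "view blank_tape = (\<lambda>_. 0)"
  by (simp add: view_def blank_tape_def)

lemma zipper_Nil: "zipper [] [] = (\<lambda>_. 0)"
  by (simp add: zipper_def fun_eq_iff)

lemma view_input_tape: "view (input_tape z) = zipper [] (map bit_symbol z)"
  by (auto simp: view_def input_tape_def zipper_def fun_eq_iff nth_default_def bit_symbol_def)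

section \<open>Reachability and halting configurations\<close>

definition reach ::
    "(nat \<times> nat list \<Rightarrow> (nat \<times> (nat \<times> move) list) option) \<Rightarrow> view_config \<Rightarrow> view_config \<Rightarrow> bool" where
  "reach m c c' \<longleftrightarrow> (\<exists>n. c' = (view_step m ^^ n) c)"

lemma reach_refl: "reach m c c"
  unfolding reach_def by (metis funpow_0)

lemma reach_step: "view_step m c = c' \<Longrightarrow> reach m c c'"
  unfolding reach_def by (rule exI [of _ 1]) simp

lemma reach_trans [trans]: "reach m c c' \<Longrightarrow> reach m c' c'' \<Longrightarrow> reach m c c''"
  unfolding reach_def by (metis comp_apply funpow_add)

text \<open>A fixed point persists, so both \<open>c1\<close> and \<open>c2\<close> are the
  configuration after as many steps as the two paths have together.\<close>

lemma reach_halted_unique: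
  assumes "reach m c c1" "reach m c c2" "view_step m c1 = c1" "view_step m c2 = c2"
  shows "c1 = c2"
proof -
  have fix_pow: "(view_step m ^^ n) d = d" if "view_step m d = d" for n d
    using that by (induction n) auto
  obtain i j where "c1 = (view_step m ^^ i) c" "c2 = (view_step m ^^ j) c"
    using assms by (auto simp: reach_def)
  then have "(view_step m ^^ j) c1 = (view_step m ^^ i) c2"
    using fun_cong [OF funpow_add [of j i "view_step m"], of c]
      fun_cong [OF funpow_add [of i j "view_step m"], of c]
    by (simp add: add.commute)
  then show ?thesis using assms fix_pow by metis
qed

text \<open>Ensures that the simulated configurations of the decider stay within the finite domain
  \<open>core_keys\<close>.\<close>

lemma config_at_wf:
  assumes "turing_machine M"
  shows "fst (config_at M z t) < num_states M \<and> length (snd (config_at M z t)) = num_tapes M \<and>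
    (\<forall>T \<in> set (snd (config_at M z t)). \<forall>i. view T i < num_symbols M)"
proof (induction t)
  case 0
  show ?case
    using assms by (auto simp: config_at_def initial_def turing_machine_def view_def
        input_tape_def blank_tape_def)
next
  case (Suc t)
  obtain p ts where c: "config_at M z t = (p, ts)" by fastforce
  show ?case
  proof (cases "applicable M (p, ts)")
    case None
    then show ?thesis using Suc by (simp add: config_at_Suc c step_def)
  next
    case (Some r)
    obtain p' acts where r: "r = (p', acts)" by fastforce
    have "((p, map scanned ts), (p', acts)) \<in> set (delta M)"
      using Some r by (auto simp: applicable_def dest: map_of_SomeD)
    then have ok: "transition_ok M ((p, map scanned ts), (p', acts))"
      using assms unfolding turing_machine_def by blast
    have "view (act a T) i < num_symbols M" if "(a, T) \<in> set (zip acts ts)" for a T i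
    proof -
      have "fst a < num_symbols M" "\<forall>i. view T i < num_symbols M"
        using set_zip_leftD [OF that] set_zip_rightD [OF that] ok Suc
        by (cases a, auto simp: c)+
      then show ?thesis by (cases a) (simp add: view_act_view view_act.simps)
    qed
    then show ?thesis
      using ok Suc by (auto simp: config_at_Suc c step_def Some r)
  qed
qed



section \<open>The self-describing machine\<close>

declare One_nat_def [simp del]

text \<open>
  The core works on the payload tape, on a counter tape with symbol 1 as mark, and on the
  output tape, which later serves as the input tape of the decider. Its state \<open>2 * j + 1\<close> executes the
  instruction number \<open>j\<close> of the program selected by the scanned symbol of the payload tape. All
  output is emitted from right to left.
\<close>

datatype instr = Emit bool | CounterLeft | CounterRight | SweepLeft | SweepRight | Tick | Next | Run

text \<open>\<open>d\<close> is the state entered by \<open>Run\<close>. A sweep keeps its state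
  while a mark is scanned, so a single instruction emits a unary number. \<open>Next\<close> returns
  to state 1, the first instruction of the program that the next payload symbol selects.\<close>

fun exec :: "nat \<Rightarrow> instr \<Rightarrow> nat \<Rightarrow> nat \<Rightarrow> nat \<Rightarrow> nat \<Rightarrow> nat \<times> (nat \<times> move) list" where
  "exec d (Emit b) p x c o' = (p + 2, [(x, Stay), (c, Stay), (bit_symbol b, MoveLeft)])"
| "exec d CounterLeft p x c o' = (p + 2, [(x, Stay), (c, MoveLeft), (o', Stay)])"
| "exec d CounterRight p x c o' = (p + 2, [(x, Stay), (c, MoveRight), (o', Stay)])"
| "exec d SweepLeft p x c o' =
     (if c = 1 then (p, [(x, Stay), (c, MoveLeft), (bit_symbol True, MoveLeft)])
      else (p + 2, [(x, Stay), (c, Stay), (o', Stay)]))"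
| "exec d SweepRight p x c o' =
     (if c = 1 then (p, [(x, Stay), (c, MoveRight), (bit_symbol True, MoveLeft)])
      else (p + 2, [(x, Stay), (c, Stay), (o', Stay)]))"
| "exec d Tick p x c o' = (p + 2, [(x, Stay), (1, MoveRight), (o', Stay)])"
| "exec d Next p x c o' = (1, [(x, MoveRight), (c, Stay), (o', Stay)])"
| "exec d Run p x c o' = (d, [(x, Stay), (c, Stay), (o', MoveRight)])"

definition emits :: "bool list \<Rightarrow> instr list" where
  "emits u = map Emit (rev u)"

text \<open>With \<open>n\<close> marks on the counter this prepends \<open>u\<close>,
  \<open>n\<close> ones, \<open>v\<close>, \<open>n\<close> ones and \<open>w\<close>. Loader
  entries and the header both contain one unary number twice up to constants, so a pass in each
  direction suffices and returns the counter head to its place.\<close>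

definition sweep_prog :: "bool list \<Rightarrow> bool list \<Rightarrow> bool list \<Rightarrow> instr list" where
  "sweep_prog u v w =
     emits w @ [CounterLeft, SweepLeft] @ emits v @ [CounterRight, SweepRight] @ emits u"

abbreviation idle :: "nat list \<Rightarrow> (nat \<times> move) list" where
  "idle as \<equiv> map (\<lambda>a. (a, Stay)) as"

text \<open>The head is on the blank in front of \<open>w\<close>, where the next bit goes.\<close>

definition otape :: "bool list \<Rightarrow> int \<Rightarrow> nat" where
  "otape w = zipper [] (0 # map bit_symbol w)"

text \<open>The head is on the blank behind the \<open>n\<close> marks. The blanks at both ends are
  explicit because the sweeps stop on them.\<close>

definition ctape :: "nat \<Rightarrow> int \<Rightarrow> nat" where
  "ctape n = zipper (replicate n 1 @ [0]) [0]"

text \<open>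
  The head is on the last of \<open>n\<close> marks, or on the blank to the left of the marks if \<open>n = 0\<close>.
\<close>

definition left_scan :: "nat \<Rightarrow> nat list \<Rightarrow> int \<Rightarrow> nat" where
  "left_scan n r =
     (case n of 0 \<Rightarrow> zipper [] (0 # r) | Suc k \<Rightarrow> zipper (replicate k 1 @ [0]) (1 # r))"

lemma otape_0 [simp]: "otape w 0 = 0"
  by (simp add: otape_def)

lemma otape_Emit [simp]: "view_act (bit_symbol b, MoveLeft) (otape w) = otape (b # w)"
  using zipper_left [of "bit_symbol b" 0 "[]" 0 "map bit_symbol w"]
  by (simp add: otape_def flip: zipper_append_blank(2))

lemma otape_right: "view_act (0, MoveRight) (otape w) = zipper [] (map bit_symbol w)"
  by (simp add: otape_def zipper_right flip: zipper_append_blank(2))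

lemma ctape_0 [simp]: "ctape n 0 = 0"
  by (simp add: ctape_def)

lemma ctape_Tick: "view_act (1, MoveRight) (ctape n) = ctape (Suc n)"
  unfolding ctape_def
  by (metis append_Cons replicate_Suc zipper_append_blank(1) zipper_right)

lemma left_scan: "view_act (b, MoveLeft) (zipper (replicate n 1 @ [0]) (c # r)) = left_scan n (b # r)"
  by (cases n) (simp_all add: left_scan_def zipper_left)

lemma ctape_left: "view_act (0, MoveLeft) (ctape n) = left_scan n [0]"
  by (simp add: ctape_def left_scan)

lemma left_scan_scanned [simp]: "left_scan n r 0 = (if n = 0 then 0 else 1)"
  by (cases n) (simp_all add: left_scan_def)

lemma left_scan_Suc: "view_act (1, MoveLeft) (left_scan (Suc n) r) = left_scan n (1 # r)"
  using left_scan [of 1 n 1 r] by (simp add: left_scan_def)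

section \<open>Construction of the machine from a supposed decider\<close>

locale decider =
  fixes D :: tm and F :: "nat set"
  assumes turing_machine_D: "turing_machine D"
begin

definition blanks :: "nat list" where
  "blanks = replicate (num_tapes D - 1) 0"

text \<open>The bit goes to the payload tape, as data for the core, and to the output tape, as part
  of the end of the self-description.\<close>

fun loader :: "nat \<Rightarrow> bool \<Rightarrow> transition" where
  "loader i b = ((2 * i + 2, 0 # 0 # 0 # blanks),
     (2 * i, (bit_symbol b, MoveLeft) # (0, Stay) # (bit_symbol b, MoveLeft) # idle blanks))"

text \<open>The leading \<open>2\<close> belongs to the clock tape: what gets written is the
  description of the clocked machine.\<close>

definition loader_scan :: "bool list" where
  "loader_scan = enc_list enc_nat (2 # 0 # 0 # 0 # blanks)"

definition loader_acts :: "bool \<Rightarrow> bool list" where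
  "loader_acts b = enc_list enc_action
     ((2, MoveRight) # (bit_symbol b, MoveLeft) # (0, Stay) # (bit_symbol b, MoveLeft) # idle blanks)"

text \<open>
  For a bit of the payload, the program prepends the encoded entry \<open>loader i b\<close>, where the counter
  tape holds \<open>2 * i\<close> marks; for the blank behind the payload, it prepends the header and then starts
  the simulation of \<open>D\<close>.
\<close>

definition prog :: "nat \<Rightarrow> instr list" where
  "prog x =
     (if x = 0 then
        sweep_prog (enc_nat (num_tapes D + 3) @ [True]) (False # enc_nat (num_symbols D)) [False] @
        [Run]
      else if x \<le> 2 then
        sweep_prog [True, True, True] (False # loader_scan) (False # loader_acts (x = 2)) @
        [Tick, Tick, Next]
      else [])"

text \<open>Positions in programs lie below this bound, which frees the odd states from
  \<open>reject\<close> on for the simulation.\<close>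

definition prog_bound :: nat where
  "prog_bound = length (prog 0) + length (prog 1) + length (prog 2)"

definition reject :: nat where
  "reject = 2 * prog_bound + 1"

definition sim :: "nat \<Rightarrow> nat" where
  "sim p = 2 * (prog_bound + p) + 3"

text \<open>The last branch is the diagonal twist: a halt of \<open>D\<close> in \<open>F\<close>
  halts the machine, any other halt sends it to \<open>reject\<close>. Neither the payload nor its
  length occurs here, so putting the encoded core into the payload is not circular.\<close>

fun core :: "nat \<times> nat list \<Rightarrow> (nat \<times> (nat \<times> move) list) option" where
  "core (p, x # c # o' # as) =
     (if p = 0 then Some (1, (x, MoveRight) # (c, Stay) # (o', Stay) # idle as)
      else if even p then None
      else if p div 2 < length (prog x) then
        (let (p', acts) = exec (sim (start D)) (prog x ! (p div 2)) p x c o' in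
         Some (p', acts @ idle as))
      else if p \<le> reject then None
      else let r = p div 2 - prog_bound - 1 in
        (case map_of (delta D) (r, o' # as) of
           Some (p', acts) \<Rightarrow> Some (sim p', (x, Stay) # (c, Stay) # acts)
         | None \<Rightarrow> if r \<in> F then None else Some (reject, idle (x # c # o' # as))))"
| "core _ = None"

definition core_keys :: "(nat \<times> nat list) set" where
  "core_keys = {..< sim (num_states D)} \<times>
     {as. set as \<subseteq> {..< num_symbols D} \<and> length as = num_tapes D + 2}"

text \<open>Any listing of the finite function will do, but one has to be fixed, since
  \<open>payload\<close> spells it out bit by bit.\<close>

definition core_table :: "transition list" where
  "core_table = (SOME xs. distinct (map fst xs) \<and> map_of xs = core |` core_keys)"

lemma core_table: "distinct (map fst core_table)" "map_of core_table = core |` core_keys"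
proof -
  have fin: "finite core_keys"
    unfolding core_keys_def by (intro finite_cartesian_product finite_lists_length_eq) auto
  have "finite (dom (core |` core_keys))"
    unfolding dom_restrict by (intro finite_Int disjI2 fin)
  from finite_distinct_list [OF this]
  obtain ks where ks: "set ks = dom (core |` core_keys)" "distinct ks" by (elim exE conjE)
  have "map fst (map (\<lambda>k. (k, the ((core |` core_keys) k))) ks) = ks"
    by (simp only: map_map comp_def fst_conv map_ident)
  then have "\<exists>xs. distinct (map fst xs) \<and> map_of xs = core |` core_keys"
    using ks(2) map_of_map_keys [OF ks(1)] by metis
  from someI_ex [OF this] show "distinct (map fst core_table)" "map_of core_table = core |` core_keys"
    unfolding core_table_def by simp_all
qed

definition payload :: "bool list" where
  "payload = enc_list (enc_transition \<circ> clock_transition) core_table @ enc_nat reject @ enc_int 1"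

text \<open>The order is decreasing because the core prepends the entry for \<open>i = 0\<close>
  first.\<close>

definition loaders :: "transition list" where
  "loaders = map (\<lambda>i. loader i (payload ! i)) (rev [0..<length payload])"

text \<open>The start state and the number of states are \<open>2 * length payload\<close> up to a
  constant, which is what the counter holds after the last loader entry.\<close>

definition machine :: tm where
  "machine = \<lparr>num_tapes = num_tapes D + 2, num_states = 2 * length payload + 1,
     num_symbols = num_symbols D, start = 2 * length payload, delta = loaders @ core_table\<rparr>"

lemma machine_simps [simp]:
  "num_tapes machine = num_tapes D + 2" "num_states machine = 2 * length payload + 1"
  "num_symbols machine = num_symbols D" "start machine = 2 * length payload"
  "delta machine = loaders @ core_table"
  by (simp_all add: machine_def)

section \<open>Well-formedness of the machine\<close>

lemma D_facts: "num_tapes D \<ge> 1" "num_symbols D \<ge> 3" "start D < num_states D"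
    "r \<in> set (delta D) \<Longrightarrow> transition_ok D r"
  using turing_machine_D by (auto simp: turing_machine_def)

lemma length_prog: "p < length (prog x) \<Longrightarrow> p < prog_bound"
  by (cases "x = 0"; cases "x = 1"; cases "x = 2") (auto simp: prog_bound_def prog_def)

lemma core_tableD: "r \<in> set core_table \<Longrightarrow> core (fst r) = Some (snd r) \<and> fst r \<in> core_keys"
  by (metis core_table map_of_eq_Some_iff option.distinct(1) prod.collapse restrict_in restrict_out)

lemma exec_acts:
  assumes "exec d ins p x c o' = (p', acts)" "x < n" "c < n" "o' < n" "n \<ge> 3"
  shows "length acts = 3 \<and> (\<forall>a \<in> set acts. fst a < n)"
  using assms by (cases ins) (auto simp: bit_symbol_def split: if_splits)

lemma core_acts:
  assumes "core (p, as) = Some (p', acts)" "(p, as) \<in> core_keys"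
  shows "length acts = num_tapes D + 2 \<and> (\<forall>a \<in> set acts. fst a < num_symbols D)"
proof -
  have as: "set as \<subseteq> {..< num_symbols D}" "length as = num_tapes D + 2"
    using assms(2) by (auto simp: core_keys_def)
  obtain x c o' bs where eq: "as = x # c # o' # bs"
    using assms(1) by (cases "(p, as)" rule: core.cases) auto
  consider (start) "p = 0" | (exec) "odd p" "p div 2 < length (prog x)"
    | (sim) r q' acts' where "map_of (delta D) (r, o' # bs) = Some (q', acts')"
        "acts = (x, Stay) # (c, Stay) # acts'"
    | (reject) "acts = idle as"
    using assms(1) unfolding eq by (auto simp: Let_def split: if_splits option.splits)
  then show ?thesis
  proof cases
    case start
    then show ?thesis using assms(1) as by (auto simp: eq)
  next
    case exec
    obtain q' acts' where e: "exec (sim (start D)) (prog x ! (p div 2)) p x c o' = (q', acts')"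
      by fastforce
    then have acts': "length acts' = 3 \<and> (\<forall>a \<in> set acts'. fst a < num_symbols D)"
      using as D_facts(2) by (intro exec_acts [OF e]) (auto simp: eq)
    have "p \<noteq> 0" using exec by (metis even_zero)
    then have "acts = acts' @ idle bs"
      using assms(1) exec e by (simp add: eq)
    then show ?thesis using as acts' by (auto simp: eq)
  next
    case sim
    then have "transition_ok D ((r, o' # bs), (q', acts'))"
      using D_facts(4) map_of_SomeD by metis
    then show ?thesis using sim as by (auto simp: eq)
  next
    case reject
    then show ?thesis using as by auto
  qed
qed

lemma length_enc_nat: "length (enc_nat n) = Suc n"
  by (simp add: enc_nat_def)

lemma length_enc_list_mem: "x \<in> set xs \<Longrightarrow> length (e x) < length (enc_list e xs)"
  by (induction xs) (auto simp: enc_list_def)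

text \<open>States are encoded in unary and the payload contains the encoded entry, so it is longer
  than any state in it.\<close>

lemma core_table_states:
  assumes "((p, as), (p', acts)) \<in> set core_table"
  shows "p < length payload" "p' < length payload"
proof -
  have "length (enc_transition (clock_transition ((p, as), (p', acts)))) < length payload"
    using length_enc_list_mem [OF assms, of "enc_transition \<circ> clock_transition"]
    by (simp add: payload_def)
  then show "p < length payload" "p' < length payload" by (auto simp: length_enc_nat)
qed

lemma reject_less: "reject < length payload"
  by (simp add: payload_def length_enc_nat)

lemma map_of_loaders:
  assumes "i < length payload"
  shows "map_of loaders (fst (loader i (payload ! i))) = Some (snd (loader i (payload ! i)))"
proof (rule map_of_is_SomeI)
  show "distinct (map fst loaders)"
    by (auto simp: loaders_def comp_def distinct_map inj_on_def)
  show "(fst (loader i (payload ! i)), snd (loader i (payload ! i))) \<in> set loaders"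
    using assms by (auto simp: loaders_def)
qed

lemma core_even: "core (p, as) = Some r \<Longrightarrow> p = 0 \<or> odd p"
  by (cases "(p, as)" rule: core.cases) (auto split: if_splits)

lemma turing_machine_machine: "turing_machine machine"
proof -
  have loader_keys: "\<exists>i. p = 2 * i + 2" if "(p, as) \<in> set (map fst loaders)" for p as
    using that by (auto simp: loaders_def)
  have "distinct (map fst loaders)"
    by (auto simp: loaders_def comp_def distinct_map inj_on_def)
  \<comment> \<open>Loader entries start from positive even states, core entries from 0 or an odd
    state.\<close>
  moreover have "set (map fst loaders) \<inter> set (map fst core_table) = {}"
  proof (rule ccontr)
    assume "set (map fst loaders) \<inter> set (map fst core_table) \<noteq> {}"
    then obtain p as where k: "(p, as) \<in> set (map fst loaders)" "(p, as) \<in> set (map fst core_table)"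
      by fastforce
    then obtain r where "core (p, as) = Some r" using core_tableD by fastforce
    then show False using core_even loader_keys [OF k(1)] by fastforce
  qed
  ultimately have "distinct (map fst (delta machine))"
    using core_table(1) by simp
  moreover have "transition_ok machine r" if "r \<in> set loaders" for r
    using that D_facts(1,2)
    by (auto simp: loaders_def blanks_def bit_symbol_def)
  moreover have "transition_ok machine r" if r: "r \<in> set core_table" for r
  proof -
    obtain p as p' acts where eq: "r = ((p, as), (p', acts))" by (metis prod.collapse)
    have c: "core (p, as) = Some (p', acts)" "(p, as) \<in> core_keys"
      using core_tableD [OF r] by (simp_all add: eq)
    then show ?thesis
      using core_acts [OF c] core_table_states [of p as p' acts] r
      by (auto simp: eq core_keys_def)
  qed
  ultimately have "distinct (map fst (delta machine))"
      "\<forall>r \<in> set (delta machine). transition_ok machine r"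
    by (simp, metis Un_iff machine_simps(5) set_append)
  then show ?thesis
    using D_facts(1,2) unfolding turing_machine_def by simp
qed

section \<open>Running the programs of the core\<close>

definition delta_map :: "nat \<times> nat list \<Rightarrow> (nat \<times> (nat \<times> move) list) option" where
  "delta_map = map_of (delta machine)"

lemma delta_map_core:
  assumes "p = 0 \<or> odd p"
  shows "delta_map (p, as) = (core |` core_keys) (p, as)"
proof -
  have "map_of loaders (p, as) = None"
    using assms by (auto simp: map_of_eq_None_iff loaders_def)
  then show ?thesis by (simp add: delta_map_def core_table(2) map_add_def)
qed

lemma view_idle: "map2 view_act (idle (map (\<lambda>g. g 0) gs)) gs = gs"
  by (induction gs) simp_all

definition conf :: "nat \<Rightarrow> (int \<Rightarrow> nat) \<Rightarrow> (int \<Rightarrow> nat) \<Rightarrow> (int \<Rightarrow> nat) \<Rightarrow> view_config" where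
  "conf p X C W = (p, X # C # W # replicate (num_tapes D - 1) (\<lambda>_. 0))"

lemma conf_keys:
  assumes "p < sim (num_states D)" "X 0 < 3" "C 0 < 3" "W 0 < 3"
  shows "(p, X 0 # C 0 # W 0 # blanks) \<in> core_keys"
  using assms D_facts(1,2) by (auto simp: core_keys_def blanks_def)

lemma view_step_conf:
  assumes "delta_map (p, X 0 # C 0 # W 0 # blanks) = Some (p', a # b # c # idle blanks)"
  shows "view_step delta_map (conf p X C W) = conf p' (view_act a X) (view_act b C) (view_act c W)"
proof -
  have *: "map (\<lambda>g. g 0) (replicate n (\<lambda>_. 0)) = replicate n 0" for n
    by (induction n) simp_all
  show ?thesis
    using assms view_idle [of "replicate (num_tapes D - 1) (\<lambda>_. 0)"]
    by (simp add: view_step_def conf_def * blanks_def)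
qed

text \<open>Splitting the program at \<open>ins\<close> makes \<open>length pre\<close> its
  position. The new tapes enter through equations, so that the rule applies to tapes already in
  normal form.\<close>

lemma reach_exec:
  assumes "prog (X 0) = pre @ ins # post" "X 0 < 3" "C 0 < 3" "W 0 < 3"
    and "p = 2 * length pre + 1" "view_act a X = X'" "view_act b C = C'" "view_act c W = W'"
    and "exec (sim (start D)) ins (2 * length pre + 1) (X 0) (C 0) (W 0) = (p', [a, b, c])"
  shows "reach delta_map (conf p X C W) (conf p' X' C' W')"
proof -
  have *: "length pre < length (prog (X 0))" using assms(1) by simp
  then have "p < sim (num_states D)" using length_prog assms(5) by (fastforce simp: sim_def)
  then have "delta_map (p, X 0 # C 0 # W 0 # blanks) = core (p, X 0 # C 0 # W 0 # blanks)"
    using conf_keys [of p X C W] assms by (simp add: delta_map_core)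
  moreover have "prog (X 0) ! length pre = ins" using assms(1) by simp
  then have "core (p, X 0 # C 0 # W 0 # blanks) = Some (p', a # b # c # idle blanks)"
    using * assms(5,9) by simp
  ultimately show ?thesis using view_step_conf assms(6-8) by (intro reach_step) simp
qed

lemma reach_emits:
  assumes "prog (X 0) = pre @ emits u @ post" "X 0 < 3" "C 0 < 3"
  shows "reach delta_map (conf (2 * length pre + 1) X C (otape w))
    (conf (2 * length (pre @ emits u) + 1) X C (otape (u @ w)))"
  using assms(1)
proof (induction u arbitrary: post)
  case Nil
  then show ?case by (simp add: emits_def reach_refl)
next
  case (Cons b u)
  \<comment> \<open>\<open>emits (b # u)\<close> ends in \<open>Emit b\<close>: the bit
    \<open>b\<close> is written last, to the left of \<open>u\<close>.\<close>
  have "reach delta_map (conf (2 * length pre + 1) X C (otape w))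
      (conf (2 * length (pre @ emits u) + 1) X C (otape (u @ w)))"
    using Cons.prems by (intro Cons.IH) (simp add: emits_def)
  also have "reach delta_map \<dots> (conf (2 * length (pre @ emits (b # u)) + 1) X C (otape (b # u @ w)))"
    by (rule reach_exec [where pre = "pre @ emits u" and ins = "Emit b"])
      (use Cons.prems assms in \<open>auto simp: emits_def\<close>)
  finally show ?case by simp
qed

text \<open>Induction on the marks still ahead; those already passed accumulate in \<open>r\<close>,
  ready for the sweep back.\<close>

lemma reach_SweepLeft:
  assumes "prog (X 0) = pre @ SweepLeft # post" "X 0 < 3"
  shows "reach delta_map (conf (2 * length pre + 1) X (left_scan n r) (otape w))
    (conf (2 * length (pre @ [SweepLeft]) + 1) X (zipper [] (0 # replicate n 1 @ r))
      (otape (replicate n True @ w)))"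
proof (induction n arbitrary: r w)
  case 0
  have "left_scan 0 r = zipper [] (0 # r)" by (simp add: left_scan_def)
  then show ?case
    by (intro reach_exec [where pre = pre and ins = SweepLeft]) (use assms in simp_all)
next
  case (Suc n)
  have "reach delta_map (conf (2 * length pre + 1) X (left_scan (Suc n) r) (otape w))
      (conf (2 * length pre + 1) X (left_scan n (1 # r)) (otape (True # w)))"
    by (rule reach_exec [where pre = pre and ins = SweepLeft])
      (use assms in \<open>simp_all add: left_scan_Suc\<close>)
  also note Suc.IH
  finally show ?case by (simp add: replicate_app_Cons_same)
qed

lemma reach_SweepRight:
  assumes "prog (X 0) = pre @ SweepRight # post" "X 0 < 3"
  shows "reach delta_map (conf (2 * length pre + 1) X (zipper l (replicate n 1 @ [0])) (otape w))
    (conf (2 * length (pre @ [SweepRight]) + 1) X (zipper (replicate n 1 @ l) [0])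
      (otape (replicate n True @ w)))"
proof (induction n arbitrary: l w)
  case 0
  show ?case
    by (rule reach_exec [where pre = pre and ins = SweepRight]) (use assms in simp_all)
next
  case (Suc n)
  have "reach delta_map (conf (2 * length pre + 1) X (zipper l (replicate (Suc n) 1 @ [0])) (otape w))
      (conf (2 * length pre + 1) X (zipper (1 # l) (replicate n 1 @ [0])) (otape (True # w)))"
    by (rule reach_exec [where pre = pre and ins = SweepRight])
      (use assms in \<open>simp_all add: zipper_right\<close>)
  also note Suc.IH
  finally show ?case by (simp add: replicate_app_Cons_same)
qed

lemma reach_sweep_prog:
  assumes prog: "prog (X 0) = sweep_prog u v w @ post" and X: "X 0 < 3"
  shows "reach delta_map (conf 1 X (ctape n) (otape z))
    (conf (2 * length (sweep_prog u v w) + 1) X (ctape n)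
      (otape (u @ replicate n True @ v @ replicate n True @ w @ z)))"
proof -
  let ?p1 = "emits w" let ?p2 = "?p1 @ [CounterLeft]" let ?p3 = "?p2 @ [SweepLeft]"
  let ?p4 = "?p3 @ emits v" let ?p5 = "?p4 @ [CounterRight]" let ?p6 = "?p5 @ [SweepRight]"
  let ?T = "replicate n True" let ?C = "zipper [] (0 # replicate n 1 @ [0])"
  have P: "prog (X 0) = ?p6 @ emits u @ post" using prog by (simp add: sweep_prog_def)
  have "reach delta_map (conf 1 X (ctape n) (otape z))
      (conf (2 * length ?p1 + 1) X (ctape n) (otape (w @ z)))"
    using reach_emits [of X "[]" w _ "ctape n" z] P X by simp
  also have "reach delta_map \<dots> (conf (2 * length ?p2 + 1) X (left_scan n [0]) (otape (w @ z)))"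
    by (rule reach_exec [where pre = ?p1 and ins = CounterLeft])
      (use P X in \<open>simp_all add: ctape_left\<close>)
  also have "reach delta_map \<dots> (conf (2 * length ?p3 + 1) X ?C (otape (?T @ w @ z)))"
    by (rule reach_SweepLeft) (use P X in simp_all)
  also have "reach delta_map \<dots>
      (conf (2 * length ?p4 + 1) X ?C (otape (v @ ?T @ w @ z)))"
    by (rule reach_emits) (use P X in simp_all)
  also have "reach delta_map \<dots>
      (conf (2 * length ?p5 + 1) X (zipper [0] (replicate n 1 @ [0])) (otape (v @ ?T @ w @ z)))"
    by (rule reach_exec [where pre = ?p4 and ins = CounterRight])
      (use P X in \<open>simp_all add: zipper_right\<close>)
  \<comment> \<open>The sweep back ends on the blank behind the last mark, which restores
    \<open>ctape n\<close>.\<close>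
  also have "reach delta_map \<dots> (conf (2 * length ?p6 + 1) X (ctape n) (otape (?T @ v @ ?T @ w @ z)))"
    unfolding ctape_def by (rule reach_SweepRight) (use P X in simp_all)
  also have "reach delta_map \<dots>
      (conf (2 * length (?p6 @ emits u) + 1) X (ctape n) (otape (u @ ?T @ v @ ?T @ w @ z)))"
    by (rule reach_emits) (use P X in simp_all)
  finally show ?thesis by (simp add: sweep_prog_def)
qed

section \<open>Writing the loader table and the header\<close>

definition entry :: "nat \<Rightarrow> bool list" where
  "entry i = True # enc_transition (clock_transition (loader i (payload ! i)))"

text \<open>Of the three leading ones, the first is the list marker of \<open>enc_list\<close> and
  the other two belong to the unary source state \<open>2 * i + 2\<close>.\<close>

lemma entry_eq:
  "entry i = [True, True, True] @ replicate (2 * i) True @ (False # loader_scan) @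
     replicate (2 * i) True @ False # loader_acts (payload ! i)"
  by (simp add: entry_def enc_nat_def loader_scan_def loader_acts_def replicate_append_same
      flip: append_Cons)

lemma reach_entry:
  assumes "i < length payload"
  shows "reach delta_map
    (conf 1 (zipper l (drop i (map bit_symbol payload))) (ctape (2 * i)) (otape w))
    (conf 1 (zipper (bit_symbol (payload ! i) # l) (drop (Suc i) (map bit_symbol payload)))
      (ctape (2 * Suc i)) (otape (entry i @ w)))"
proof -
  let ?b = "payload ! i" let ?r = "drop (Suc i) (map bit_symbol payload)"
  let ?X = "zipper l (bit_symbol ?b # ?r)" let ?w = "entry i @ w"
  let ?s = "sweep_prog [True, True, True] (False # loader_scan) (False # loader_acts ?b)"
  have drop: "drop i (map bit_symbol payload) = bit_symbol ?b # ?r"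
    using assms by (metis Cons_nth_drop_Suc length_map nth_map)
  have X: "?X 0 < 3" by (simp add: bit_symbol_def)
  have P: "prog (?X 0) = ?s @ [Tick, Tick, Next]" by (simp add: prog_def bit_symbol_def)
  have "reach delta_map (conf 1 ?X (ctape (2 * i)) (otape w))
      (conf (2 * length ?s + 1) ?X (ctape (2 * i)) (otape ?w))"
    using reach_sweep_prog [of ?X _ _ _ _ "2 * i" w, OF P X] by (simp add: entry_eq)
  also have "reach delta_map \<dots> (conf (2 * length (?s @ [Tick]) + 1) ?X (ctape (Suc (2 * i))) (otape ?w))"
    by (rule reach_exec [where pre = ?s and ins = Tick]) (use P X in \<open>simp_all add: ctape_Tick\<close>)
  also have "reach delta_map \<dots>
      (conf (2 * length (?s @ [Tick, Tick]) + 1) ?X (ctape (2 * Suc i)) (otape ?w))"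
    by (rule reach_exec [where pre = "?s @ [Tick]" and ins = Tick])
      (use P X in \<open>simp_all add: ctape_Tick\<close>)
  also have "reach delta_map \<dots>
      (conf 1 (zipper (bit_symbol ?b # l) ?r) (ctape (2 * Suc i)) (otape ?w))"
    by (rule reach_exec [where pre = "?s @ [Tick, Tick]" and ins = Next])
      (use P X in \<open>simp_all add: zipper_right\<close>)
  finally show ?thesis by (simp add: drop)
qed

lemma reach_entries:
  assumes "i \<le> length payload"
  shows "\<exists>l. reach delta_map
    (conf 1 (zipper [] (map bit_symbol payload)) (ctape 0) (otape payload))
    (conf 1 (zipper l (drop i (map bit_symbol payload))) (ctape (2 * i))
      (otape (concat (map entry (rev [0..<i])) @ payload)))"
  using assms
proof (induction i)
  case 0
  show ?case by (rule exI [of _ "[]"]) (simp add: reach_refl)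
next
  case (Suc i)
  then obtain l where l: "reach delta_map
      (conf 1 (zipper [] (map bit_symbol payload)) (ctape 0) (otape payload))
      (conf 1 (zipper l (drop i (map bit_symbol payload))) (ctape (2 * i))
        (otape (concat (map entry (rev [0..<i])) @ payload)))"
    using Suc_leD by blast
  have "i < length payload" using Suc.prems by simp
  note reach_trans [OF l reach_entry [OF this]]
  moreover have "entry i @ concat (map entry (rev [0..<i])) @ payload =
      concat (map entry (rev [0..<Suc i])) @ payload"
    by simp
  ultimately show ?case by (intro exI) (simp only:)
qed

definition code :: "bool list" where
  "code = encode (clocked machine) reject 1"

text \<open>This is the output of \<open>prog 0\<close>: \<open>num_tapes D + 3\<close> includes the
  payload, counter and clock tapes, the extra \<open>True\<close> makes the state count one larger
  than the start state, and \<open>[False]\<close> closes the start state.\<close>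

lemma code_eq:
  "code = (enc_nat (num_tapes D + 3) @ [True]) @ replicate (2 * length payload) True @
     (False # enc_nat (num_symbols D)) @ replicate (2 * length payload) True @ [False] @
     concat (map entry (rev [0..<length payload])) @ payload"
proof -
  have "enc_list enc_transition (map clock_transition (loaders @ core_table)) =
      concat (map entry (rev [0..<length payload])) @
      enc_list (enc_transition \<circ> clock_transition) core_table"
    by (simp add: enc_list_def loaders_def entry_def [abs_def] comp_def)
  then have "code = enc_nat (num_tapes D + 3) @ enc_nat (Suc (2 * length payload)) @
      enc_nat (num_symbols D) @ enc_nat (2 * length payload) @
      concat (map entry (rev [0..<length payload])) @ payload"
    by (simp add: code_def encode_def enc_tm_def clocked_def numeral_3_eq_3)
      (simp add: payload_def)
  moreover have "enc_nat (Suc n) = True # replicate n True @ [False]"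
    "enc_nat n = replicate n True @ [False]" for n
    by (simp_all add: enc_nat_def)
  ultimately show ?thesis
    by (simp only: append_assoc append_Cons append_Nil replicate_Suc)
qed

lemma reach_run:
  "\<exists>l. reach delta_map
    (conf 1 (zipper [] (map bit_symbol payload)) (ctape 0) (otape payload))
    (conf (sim (start D)) (zipper l []) (ctape (2 * length payload))
      (zipper [] (map bit_symbol code)))"
proof -
  let ?n = "2 * length payload" let ?e = "concat (map entry (rev [0..<length payload])) @ payload"
  let ?s = "sweep_prog (enc_nat (num_tapes D + 3) @ [True]) (False # enc_nat (num_symbols D)) [False]"
  obtain l where l: "reach delta_map
      (conf 1 (zipper [] (map bit_symbol payload)) (ctape 0) (otape payload))
      (conf 1 (zipper l []) (ctape ?n) (otape ?e))"
    using reach_entries [of "length payload"] by auto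
  let ?X = "zipper l []"
  \<comment> \<open>Behind the payload a blank is scanned, which selects
    \<open>prog 0\<close>.\<close>
  have X: "?X 0 < 3" by simp
  have P: "prog (?X 0) = ?s @ [Run]" by (simp add: prog_def)
  note l
  also have "reach delta_map (conf 1 ?X (ctape ?n) (otape ?e))
      (conf (2 * length ?s + 1) ?X (ctape ?n) (otape code))"
    using reach_sweep_prog [of ?X _ _ _ _ ?n ?e, OF P X] by (simp add: code_eq)
  also have "reach delta_map \<dots>
      (conf (sim (start D)) ?X (ctape ?n) (zipper [] (map bit_symbol code)))"
    by (rule reach_exec [where pre = ?s and ins = Run]) (use P X in \<open>simp_all add: otape_right\<close>)
  finally show ?thesis by blast
qed

text \<open>Loader states count down while bits are written from last to first, hence the downward
  induction from \<open>length payload\<close>.\<close>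

lemma reach_load:
  assumes "i \<le> length payload"
  shows "reach delta_map (conf (2 * length payload) (otape []) (ctape 0) (otape []))
    (conf (2 * i) (otape (drop i payload)) (ctape 0) (otape (drop i payload)))"
  using assms
proof (induction rule: inc_induct)
  case base
  show ?case by (simp add: reach_refl)
next
  case (step i)
  have "delta_map (2 * Suc i, 0 # 0 # 0 # blanks) =
      Some (2 * i, (bit_symbol (payload ! i), MoveLeft) # (0, Stay) #
        (bit_symbol (payload ! i), MoveLeft) # idle blanks)"
    using map_of_loaders [OF step(2)] by (simp add: delta_map_def map_add_def)
  from view_step_conf [of "2 * Suc i" "otape (drop (Suc i) payload)" "ctape 0"
      "otape (drop (Suc i) payload)", simplified otape_0 ctape_0, OF this]
  have "reach delta_map
      (conf (2 * Suc i) (otape (drop (Suc i) payload)) (ctape 0) (otape (drop (Suc i) payload)))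
      (conf (2 * i) (otape (drop i payload)) (ctape 0) (otape (drop i payload)))"
    using step(2) by (intro reach_step) (simp add: Cons_nth_drop_Suc)
  with step.IH show ?case by (rule reach_trans)
qed

lemma view_config_initial:
  "view_config (initial machine []) = conf (2 * length payload) (otape []) (ctape 0) (otape [])"
proof -
  have "otape [] = (\<lambda>_. 0)"
    by (simp add: otape_def zipper_Nil flip: zipper_append_blank(1))
  moreover have "ctape 0 = (\<lambda>_. 0)"
    by (simp add: ctape_def zipper_Nil flip: zipper_append_blank)
  moreover have "replicate (num_tapes D) a = a # replicate (num_tapes D - 1) a" for a :: "int \<Rightarrow> nat"
    using D_facts(1) by (cases "num_tapes D") simp_all
  ultimately show ?thesis
    by (simp add: view_config_def initial_def conf_def view_blank view_input_tape zipper_Nil)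
qed

lemma reach_boot:
  "reach delta_map (view_config (initial machine []))
    (conf 1 (zipper [] (map bit_symbol payload)) (ctape 0) (otape payload))"
proof -
  \<comment> \<open>State 0 moves only the payload head, onto the first bit; the output head stays
    on the blank in front of the output.\<close>
  have "delta_map (0, otape payload 0 # ctape 0 0 # otape payload 0 # blanks) =
      Some (1, (0, MoveRight) # (0, Stay) # (0, Stay) # idle blanks)"
    using conf_keys [of 0 "otape payload" "ctape 0" "otape payload"]
    by (simp add: delta_map_core sim_def)
  then have "view_step delta_map (conf 0 (otape payload) (ctape 0) (otape payload)) =
      conf 1 (zipper [] (map bit_symbol payload)) (ctape 0) (otape payload)"
    using view_step_conf [of 0 "otape payload" "ctape 0" "otape payload"] by (simp add: otape_right)
  moreover have "reach delta_map (view_config (initial machine []))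
      (conf 0 (otape payload) (ctape 0) (otape payload))"
    using reach_load [of 0] by (simp add: view_config_initial)
  ultimately show ?thesis using reach_step reach_trans by blast
qed

section \<open>Simulation of the decider on the self-description\<close>

definition sim_conf :: "(int \<Rightarrow> nat) \<Rightarrow> (int \<Rightarrow> nat) \<Rightarrow> config \<Rightarrow> view_config" where
  "sim_conf X C cfg = (sim (fst cfg), X # C # map view (snd cfg))"

lemma core_sim:
  "core (sim p, 0 # c # o' # as) =
     (case map_of (delta D) (p, o' # as) of
       Some (p', acts) \<Rightarrow> Some (sim p', (0, Stay) # (c, Stay) # acts)
     | None \<Rightarrow> if p \<in> F then None else Some (reject, idle (0 # c # o' # as)))"
proof -
  have "sim p div 2 = prog_bound + p + 1" by (simp add: sim_def)
  moreover have "odd (sim p)" "sim p \<noteq> 0" "\<not> sim p \<le> reject"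
    by (simp_all add: sim_def reject_def)
  moreover have "\<not> prog_bound + p + 1 < length (prog 0)"
    using length_prog [of "prog_bound + p + 1" 0] by auto
  ultimately show ?thesis by (simp add: Let_def)
qed

lemma delta_map_sim:
  assumes "X 0 = 0" "C 0 = 0"
  shows "delta_map (sim (fst (config_at D z t)),
      map (\<lambda>g. g 0) (snd (sim_conf X C (config_at D z t)))) =
    (case applicable D (config_at D z t) of
      Some (p', acts) \<Rightarrow> Some (sim p', (0, Stay) # (0, Stay) # acts)
    | None \<Rightarrow> if fst (config_at D z t) \<in> F then None
        else Some (reject, idle (0 # 0 # map scanned (snd (config_at D z t)))))"
proof -
  obtain p ts where c: "config_at D z t = (p, ts)" by fastforce
  have wf: "p < num_states D" "length ts = num_tapes D"
      "\<forall>T \<in> set ts. scanned T < num_symbols D"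
    using config_at_wf [OF turing_machine_D, of z t] by (auto simp: c simp flip: view_0)
  obtain T us where ts: "ts = T # us" using wf D_facts(1) by (cases ts) auto
  have "(sim p, 0 # 0 # map scanned ts) \<in> core_keys"
    using wf D_facts(2) by (auto simp: core_keys_def sim_def)
  moreover have "odd (sim p)" by (simp add: sim_def)
  ultimately have "delta_map (sim p, 0 # 0 # map scanned ts) = core (sim p, 0 # 0 # map scanned ts)"
    by (simp add: delta_map_core)
  also have "\<dots> = (case applicable D (p, ts) of
      Some (p', acts) \<Rightarrow> Some (sim p', (0, Stay) # (0, Stay) # acts)
    | None \<Rightarrow> if p \<in> F then None else Some (reject, idle (0 # 0 # map scanned ts)))"
    by (simp only: ts list.map core_sim applicable_def fst_conv snd_conv)
  finally show ?thesis
    unfolding c fst_conv snd_conv by (simp add: sim_conf_def assms view_0 comp_def)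
qed

lemma reach_sim:
  assumes "X 0 = 0" "C 0 = 0"
  shows "reach delta_map (sim_conf X C (config_at D z 0)) (sim_conf X C (config_at D z t))"
proof (induction t)
  case 0
  show ?case by (rule reach_refl)
next
  case (Suc t)
  obtain p ts where c: "config_at D z t = (p, ts)" by fastforce
  have "reach delta_map (sim_conf X C (p, ts)) (sim_conf X C (step D (p, ts)))"
  proof (cases "applicable D (p, ts)")
    case None
    \<comment> \<open>A halted \<open>D\<close> repeats its configuration, so zero steps simulate
      it.\<close>
    then show ?thesis by (simp add: step_def reach_refl)
  next
    case (Some r)
    then have "view_step delta_map (sim_conf X C (p, ts)) = sim_conf X C (step D (p, ts))"
      using delta_map_sim [of X C z t, OF assms]
      by (cases r) (simp add: c view_step_def step_def sim_conf_def assms flip: map2_view_act)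
    then show ?thesis by (rule reach_step)
  qed
  with Suc.IH show ?case
    unfolding c config_at_Suc by (rule reach_trans)
qed

lemma view_step_reject: "fst c = reject \<Longrightarrow> view_step delta_map c = c"
proof -
  have "\<not> prog_bound < length (prog x)" for x using length_prog by blast
  then have "core (reject, as) = None" for as
    by (cases "(reject, as)" rule: core.cases) (simp_all add: reject_def)
  then have "delta_map (reject, as) = None" for as
    by (simp add: delta_map_core reject_def restrict_map_def)
  then show "fst c = reject \<Longrightarrow> view_step delta_map c = c"
    by (simp add: view_step_def)
qed

lemma enters_reject:
  assumes halted: "halted D (config_at D code t)"
  shows "enters machine [] reject \<longleftrightarrow> fst (config_at D code t) \<notin> F"
proof -
  let ?init = "view_config (initial machine [])"
  obtain l where l: "reach delta_map
      (conf 1 (zipper [] (map bit_symbol payload)) (ctape 0) (otape payload))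
      (conf (sim (start D)) (zipper l []) (ctape (2 * length payload))
      (zipper [] (map bit_symbol code)))"
    using reach_run by blast
  let ?X = "zipper l []" let ?C = "ctape (2 * length payload)"
  \<comment> \<open>The output tape becomes the input tape of \<open>D\<close>; its absolute head
    position is invisible in views.\<close>
  have "conf (sim (start D)) ?X ?C (zipper [] (map bit_symbol code)) = sim_conf ?X ?C (config_at D code 0)"
    by (simp add: conf_def sim_conf_def config_at_def initial_def view_input_tape view_blank)
  then have "reach delta_map ?init (sim_conf ?X ?C (config_at D code 0))"
    using reach_trans [OF reach_boot l] by (simp only:)
  also have "reach delta_map \<dots> (sim_conf ?X ?C (config_at D code t))"
    by (rule reach_sim) simp_all
  finally have to_halt: "reach delta_map ?init (sim_conf ?X ?C (config_at D code t))" .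
  have delta: "delta_map (sim (fst (config_at D code t)),
      map (\<lambda>g. g 0) (snd (sim_conf ?X ?C (config_at D code t)))) =
    (if fst (config_at D code t) \<in> F then None
     else Some (reject, idle (0 # 0 # map scanned (snd (config_at D code t)))))"
    using delta_map_sim [of ?X ?C code t] halted by (simp add: halted_def)
  \<comment> \<open>\<open>e\<close> is where the machine comes to rest: at the simulated halt if
    that is in \<open>F\<close>, otherwise one step later in \<open>reject\<close>.\<close>
  obtain e where e: "reach delta_map ?init e" "view_step delta_map e = e"
    "fst e = reject \<longleftrightarrow> fst (config_at D code t) \<notin> F"
  proof (cases "fst (config_at D code t) \<in> F")
    case True
    then have "view_step delta_map (sim_conf ?X ?C (config_at D code t)) =
        sim_conf ?X ?C (config_at D code t)"
      using delta by (simp add: view_step_def sim_conf_def)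
    moreover have "sim p \<noteq> reject" for p by (simp add: sim_def reject_def)
    ultimately show ?thesis using that [OF to_halt] True by (simp add: sim_conf_def)
  next
    case False
    let ?e = "view_step delta_map (sim_conf ?X ?C (config_at D code t))"
    have "fst ?e = reject"
      using delta False by (simp add: view_step_def sim_conf_def)
    then show ?thesis
      using that [OF reach_trans [OF to_halt reach_step [OF refl]] view_step_reject] False by simp
  qed
  have fst_config: "fst (config_at machine [] s) = fst ((view_step delta_map ^^ s) ?init)" for s
    unfolding delta_map_def view_config_at [symmetric] by (simp add: view_config_def)
  show ?thesis
  proof
    assume "enters machine [] reject"
    then obtain s where s: "fst ((view_step delta_map ^^ s) ?init) = reject"
      unfolding enters_def fst_config by (rule exE)
    have "reach delta_map ?init ((view_step delta_map ^^ s) ?init)"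
      unfolding reach_def by (rule exI) (rule refl)
    \<comment> \<open>A configuration in state \<open>reject\<close> is at rest and hence equals
      \<open>e\<close>.\<close>
    from reach_halted_unique [OF this e(1) view_step_reject [OF s] e(2)]
    have "fst e = reject" using s by (rule subst)
    then show "fst (config_at D code t) \<notin> F" by (rule e(3) [THEN iffD1])
  next
    assume "fst (config_at D code t) \<notin> F"
    then have "fst e = reject" by (rule e(3) [THEN iffD2])
    with e(1) show "enters machine [] reject"
      unfolding enters_def fst_config reach_def by (elim exE) (simp only:, rule exI)
  qed
qed

end

section \<open>Refutation of the supposed decider\<close>

theorem proposition10:
  "\<nexists>D F. turing_machine D \<and> F \<subseteq> {..<num_states D} \<and>
     (\<forall>M q c. turing_machine M \<longrightarrow> q < num_states M \<longrightarrow> linear_time M c \<longrightarrow>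
        answers D F (encode M q c) (\<exists>z. enters M z q))"
proof
  assume "\<exists>D F. turing_machine D \<and> F \<subseteq> {..<num_states D} \<and>
     (\<forall>M q c. turing_machine M \<longrightarrow> q < num_states M \<longrightarrow> linear_time M c \<longrightarrow>
        answers D F (encode M q c) (\<exists>z. enters M z q))"
  then obtain D F where "turing_machine D" and D: "\<And>M q c. turing_machine M \<Longrightarrow>
      q < num_states M \<Longrightarrow> linear_time M c \<Longrightarrow> answers D F (encode M q c) (\<exists>z. enters M z q)"
    by blast
  then interpret decider D F by unfold_locales
  have tapes: "num_tapes machine \<ge> 1" by simp
  have "reject < num_states (clocked machine)"
    using reject_less by (simp add: clocked_def)
  \<comment> \<open>The promise holds with \<open>c = 1\<close>, the very constant encoded at the
    end of \<open>payload\<close>, so \<open>D\<close> has to answer on \<open>code\<close>, and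
    correctly; \<open>enters_reject\<close> forces the opposite answer.\<close>
  from D [OF turing_machine_clocked [OF turing_machine_machine] this linear_time_clocked [OF tapes]]
  have "answers D F code (enters machine [] reject)"
    by (simp only: code_def enters_clocked [OF tapes])
  then obtain t where "halted D (config_at D code t)"
      "fst (config_at D code t) \<in> F \<longleftrightarrow> enters machine [] reject"
    unfolding answers_def by (elim exE conjE)
  with enters_reject show False by simp
qed

end
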